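(* There do not exist integers $b,c,d,e$ with $e\neq 0$ such that the real quaternion $\frac{1}{e}\left(b\sqrt{2}\,\mathbf{i} + c\sqrt{5}\,\mathbf{j} + d\sqrt{10}\,\mathbf{k}\right)$ has norm $1$.
   Context: Real quaternions are $a_1+a_2\mathbf{i}+a_3\mathbf{j}+a_4\mathbf{k}$ with $a_t\in\mathbb{R}$, where $\mathbf{i}^2=\mathbf{j}^2=\mathbf{k}^2=\mathbf{i}\mathbf{j}\mathbf{k}=-1$. The norm is $N(a_1+a_2\mathbf{i}+a_3\mathbf{j}+a_4\mathbf{k}) = a_1^2+a_2^2+a_3^2+a_4^2$. *)

theory Defs
  imports Complex_Main
begin

datatype quat = Quat (Q1: real) (Qi: real) (Qj: real) (Qk: real)

lemma quat_eq_iff: "x = y \<longleftrightarrow> Q1 x = Q1 y \<and> Qi x = Qi y \<and> Qj x = Qj y \<and> Qk x = Qk y"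
  by (cases x; cases y) simp

instantiation quat :: real_algebra_1
begin

definition "0 = Quat 0 0 0 0"

definition "1 = Quat 1 0 0 0"

definition "x + y = Quat (Q1 x + Q1 y) (Qi x + Qi y) (Qj x + Qj y) (Qk x + Qk y)"

definition "- x = Quat (- Q1 x) (- Qi x) (- Qj x) (- Qk x)"

definition "x - y = Quat (Q1 x - Q1 y) (Qi x - Qi y) (Qj x - Qj y) (Qk x - Qk y)"

definition "r *\<^sub>R x = Quat (r * Q1 x) (r * Qi x) (r * Qj x) (r * Qk x)"

definition
  "x * y = Quat
    (Q1 x * Q1 y - Qi x * Qi y - Qj x * Qj y - Qk x * Qk y)
    (Q1 x * Qi y + Qi x * Q1 y + Qj x * Qk y - Qk x * Qj y)
    (Q1 x * Qj y - Qi x * Qk y + Qj x * Q1 y + Qk x * Qi y)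
    (Q1 x * Qk y + Qi x * Qj y - Qj x * Qi y + Qk x * Q1 y)"

instance
  by standard
    (simp_all add: quat_eq_iff zero_quat_def one_quat_def plus_quat_def uminus_quat_def
      minus_quat_def scaleR_quat_def times_quat_def algebra_simps)

end

definition quat_i :: quat where "quat_i = Quat 0 1 0 0"

definition quat_j :: quat where "quat_j = Quat 0 0 1 0"

definition quat_k :: quat where "quat_k = Quat 0 0 0 1"

lemma quat_basis:
  "Quat a1 a2 a3 a4 = of_real a1 + a2 *\<^sub>R quat_i + a3 *\<^sub>R quat_j + a4 *\<^sub>R quat_k"
  by (simp add: of_real_def quat_i_def quat_j_def quat_k_def one_quat_def plus_quat_def
      scaleR_quat_def)

lemma quat_units:
  "quat_i * quat_i = - 1" "quat_j * quat_j = - 1" "quat_k * quat_k = - 1"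
  "quat_i * quat_j * quat_k = - 1"
  by (simp_all add: quat_i_def quat_j_def quat_k_def one_quat_def uminus_quat_def times_quat_def)

text \<open>The norm is the sum of squares (the reduced norm), not its square root.\<close>

definition quat_norm :: "quat \<Rightarrow> real" where
  "quat_norm x = (Q1 x)\<^sup>2 + (Qi x)\<^sup>2 + (Qj x)\<^sup>2 + (Qk x)\<^sup>2"

end

theory Submission
  imports Defs
begin

text \<open>
  Clearing denominators turns norm 1 into \<open>2 b\<^sup>2 + 5 c\<^sup>2 + 10 d\<^sup>2 = e\<^sup>2\<close>. Neither 2 nor -2 is a square
  modulo 5, so reducing modulo 5 forces 5 to divide \<open>b\<close> and \<open>e\<close>; dividing by 5 and reducing again
  forces 5 to divide \<open>c\<close> and \<open>d\<close>. Infinite descent on \<open>e\<close> concludes.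
\<close>

text \<open>The residue 0 is paired with \<open>5 dvd x\<close>, so that later arguments can treat
  \<open>x\<^sup>2\<close> as an opaque integer.\<close>

lemma square_mod_5_cases:
  fixes x :: int
  shows "x\<^sup>2 mod 5 = 0 \<and> 5 dvd x \<or> x\<^sup>2 mod 5 = 1 \<or> x\<^sup>2 mod 5 = 4"
proof -
  have "x mod 5 = 0 \<or> x mod 5 = 1 \<or> x mod 5 = 2 \<or> x mod 5 = 3 \<or> x mod 5 = 4"
    by presburger
  then have "(x mod 5)\<^sup>2 mod 5 = 0 \<and> 5 dvd x \<or> (x mod 5)\<^sup>2 mod 5 = 1 \<or> (x mod 5)\<^sup>2 mod 5 = 4"
    \<comment> \<open>As a simp rule, \<open>power_mod\<close> would strip the inner
      \<open>mod 5\<close> before the residue is substituted.\<close>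
    by (elim disjE) (simp_all add: dvd_eq_mod_eq_0 del: power_mod)
  then show ?thesis
    by (simp only: power_mod)
qed

text \<open>Modulo 5, \<open>2 * x\<^sup>2\<close> lies in {0, 2, 3} and \<open>y\<^sup>2\<close> in
  {0, 1, 4}; they agree only at 0.\<close>

lemma five_dvd_twice_square_diff:
  fixes x y :: int
  assumes "5 dvd 2 * x\<^sup>2 - y\<^sup>2"
  shows "5 dvd x \<and> 5 dvd y"
  using assms square_mod_5_cases[of x] square_mod_5_cases[of y] by presburger

text \<open>Since -1 is a square modulo 5, \<open>- y\<^sup>2\<close> also lies in {0, 1, 4}, so the
  sign changes nothing.\<close>

lemma five_dvd_twice_square_add:
  fixes x y :: int
  assumes "5 dvd 2 * x\<^sup>2 + y\<^sup>2"
  shows "5 dvd x \<and> 5 dvd y"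
  using assms square_mod_5_cases[of x] square_mod_5_cases[of y] by presburger

lemma ternary_form_eq_square_imp_zero:
  fixes b c d e :: int
  assumes "2 * b\<^sup>2 + 5 * c\<^sup>2 + 10 * d\<^sup>2 = e\<^sup>2"
  shows "e = 0"
  using assms
proof (induction "nat \<bar>e\<bar>" arbitrary: b c d e rule: less_induct)
  case less
  have "2 * b\<^sup>2 - e\<^sup>2 = 5 * (- c\<^sup>2 - 2 * d\<^sup>2)"
    using less.prems by simp
  then have "5 dvd b \<and> 5 dvd e"
    using five_dvd_twice_square_diff by (metis dvd_triv_left)
  then obtain b' e' where be: "b = 5 * b'" "e = 5 * e'"
    by (auto elim!: dvdE)
  \<comment> \<open>The equation after substituting for \<open>b\<close> and \<open>e\<close> and
    cancelling one factor 5.\<close>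
  have "2 * d\<^sup>2 + c\<^sup>2 = 5 * (e'\<^sup>2 - 2 * b'\<^sup>2)"
    using less.prems by (simp add: be power_mult_distrib)
  then have "5 dvd d \<and> 5 dvd c"
    using five_dvd_twice_square_add by (metis dvd_triv_left)
  then obtain c' d' where cd: "c = 5 * c'" "d = 5 * d'"
    by (auto elim!: dvdE)
  \<comment> \<open>By homogeneity a common factor 25 cancels.\<close>
  have eq': "2 * b'\<^sup>2 + 5 * c'\<^sup>2 + 10 * d'\<^sup>2 = e'\<^sup>2"
    using less.prems by (simp add: be cd power_mult_distrib)
  show ?case
  proof (rule ccontr)
    assume "e \<noteq> 0"
    then have "nat \<bar>e'\<bar> < nat \<bar>e\<bar>"
      using be by simp
    from less.hyps[OF this eq'] show False
      using \<open>e \<noteq> 0\<close> be by simp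
  qed
qed

theorem theorem34:
  "\<not> (\<exists>b c d e :: int. e \<noteq> 0 \<and>
      quat_norm ((1 / of_int e) *\<^sub>R
        ((of_int b * sqrt 2) *\<^sub>R quat_i + (of_int c * sqrt 5) *\<^sub>R quat_j
          + (of_int d * sqrt 10) *\<^sub>R quat_k)) = 1)"
proof (intro notI, elim exE conjE)
  fix b c d e :: int
  assume e: "e \<noteq> 0"
    and norm: "quat_norm ((1 / of_int e) *\<^sub>R
        ((of_int b * sqrt 2) *\<^sub>R quat_i + (of_int c * sqrt 5) *\<^sub>R quat_j
          + (of_int d * sqrt 10) *\<^sub>R quat_k)) = 1"
  \<comment> \<open>Squaring the coordinates removes the roots, leaving an equation between integers
    that the descent can use.\<close>
  have "2 * (real_of_int b)\<^sup>2 + 5 * (real_of_int c)\<^sup>2 + 10 * (real_of_int d)\<^sup>2 = (real_of_int e)\<^sup>2"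
    using norm e
    by (simp add: quat_norm_def quat_i_def quat_j_def quat_k_def scaleR_quat_def plus_quat_def
        divide_simps)
  then have "real_of_int (2 * b\<^sup>2 + 5 * c\<^sup>2 + 10 * d\<^sup>2) = real_of_int (e\<^sup>2)"
    by simp
  then have "2 * b\<^sup>2 + 5 * c\<^sup>2 + 10 * d\<^sup>2 = e\<^sup>2"
    by (simp only: of_int_eq_iff)
  with e show False
    using ternary_form_eq_square_imp_zero by blast
qed

end
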